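(* Let $F^+=\langle x_0,x_1,\dots\mid x_nx_k=x_kx_{n+1},\ k<n\rangle$ be Thompson's monoid and let $T:F^+\to\mathcal{B}(\mathcal{H})$ be a unital contractive representation on a Hilbert space $\mathcal{H}$ (uniquely determined by $T_i=T(x_i)$). Then $T$ has a $\ast$-regular dilation if and only if for every finite subset $F$ of the set of generators $\{x_0,x_1,\dots\}$, $$Z(F)=\sum_{U\subseteq F}(-1)^{|U|}\,TT^*(\vee U)\ \ge\ 0.$$
   Context: $F^+$ is the unital semigroup (identity $e$) with the given presentation. It is known that $P=F^+$ is a right LCM semigroup: left cancellative, and for all $p,q\in P$ either $pP\cap qP=\emptyset$ or $pP\cap qP=rP$ for some $r\in P$. For finite $F\subset P$, $\vee F=\{r\in P:\bigcap_{x\in F}xP=rP\}$ (a possibly empty set; $\vee\emptyset$ is the set of invertible elements), $p\vee q=\vee\{p,q\}$. If $s\in pP$, $p^{-1}s$ is the unique $t$ with $pt=s$. A unital contractive representation satisfies $T(e)=I$, $T(pq)=T(p)T(q)$, $\|T(p)\|\le1$. $TT^*(p)=T(p)T(p)^*$; $TT^*(\vee U)=TT^*(r)$ for any $r\in\vee U$, and $0$ if $\vee U$ is the empty set. The term $U=\emptyset$ of $Z(F)$ is $I$. $T$ has a $\ast$-regular dilation if the kernel $K(p,q)=T(p^{-1}s)T(q^{-1}s)^*$ for $s\in p\vee q$ (and $K(p,q)=0$ if $p\vee q=\emptyset$) is completely positive definite, i.e. $[K(p_i,p_j)]_{i,j}\ge0$ for all $p_1,\dots,p_n\in P$. *)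

theory Defs
  imports "HOL-Analysis.Analysis"
begin

section \<open>Complex Hilbert spaces\<close>

class complex_hilbert_space = banach +
  fixes scaleC :: "complex \<Rightarrow> 'a \<Rightarrow> 'a"  (infixr \<open>*\<^sub>C\<close> 75)
    and cinner :: "'a \<Rightarrow> 'a \<Rightarrow> complex"
  assumes scaleR_scaleC: "r *\<^sub>R x = complex_of_real r *\<^sub>C x"
    and scaleC_add_right: "a *\<^sub>C (x + y) = a *\<^sub>C x + a *\<^sub>C y"
    and scaleC_add_left: "(a + b) *\<^sub>C x = a *\<^sub>C x + b *\<^sub>C x"
    and scaleC_scaleC: "a *\<^sub>C b *\<^sub>C x = (a * b) *\<^sub>C x"
    and cinner_commute: "cinner x y = cnj (cinner y x)"
    and cinner_add_left: "cinner (x + y) z = cinner x z + cinner y z"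
    and cinner_scaleC_left: "cinner (a *\<^sub>C x) y = a * cinner x y"
    and cinner_self: "cinner x x = complex_of_real ((norm x)\<^sup>2)"

text \<open>
  The type of bounded \<^emph>\<open>real\<close>-linear operators from the library is used for its norm, sum and
  composition; elements of \<open>B(H)\<close> are those that are in addition complex-linear.
\<close>

definition complex_linear :: "('h::complex_hilbert_space \<Rightarrow>\<^sub>L 'h) \<Rightarrow> bool" where
  "complex_linear A \<longleftrightarrow> (\<forall>c x. A (c *\<^sub>C x) = c *\<^sub>C A x)"

text \<open>
  For a complex-linear \<open>A\<close> such a \<open>B\<close> exists by the Riesz representation theorem, is unique and is
  again complex-linear.
\<close>

definition adjoint_op ::
    "('h::complex_hilbert_space \<Rightarrow>\<^sub>L 'h) \<Rightarrow> ('h \<Rightarrow>\<^sub>L 'h)" where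
  "adjoint_op A = (THE B :: 'h \<Rightarrow>\<^sub>L 'h. \<forall>x y. cinner (A x) y = cinner x (B y))"

definition positive_op :: "('h::complex_hilbert_space \<Rightarrow>\<^sub>L 'h) \<Rightarrow> bool" where
  "positive_op A \<longleftrightarrow> (\<forall>x. cinner (A x) x \<in> \<real>\<^sub>\<ge>\<^sub>0)"

section \<open>Right ideals and least common multiples in a monoid\<close>

definition right_ideal :: "'p::monoid_mult \<Rightarrow> 'p set" where
  "right_ideal p = range (\<lambda>t. p * t)"

definition lcms :: "'p::monoid_mult set \<Rightarrow> 'p set" where
  "lcms F = {r. (\<Inter>x\<in>F. right_ideal x) = right_ideal r}"

text \<open>The element \<open>p\<^sup>-\<^sup>1 s\<close>, meaningful if \<open>s \<in> right_ideal p\<close> and the monoid is left cancellative.\<close>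

definition left_quotient :: "'p::monoid_mult \<Rightarrow> 'p \<Rightarrow> 'p" where
  "left_quotient p s = (THE t. p * t = s)"

section \<open>Contractive representations and \<open>*\<close>-regular dilations\<close>

definition contractive_representation ::
    "('p::monoid_mult \<Rightarrow> 'h::complex_hilbert_space \<Rightarrow>\<^sub>L 'h) \<Rightarrow> bool" where
  "contractive_representation T \<longleftrightarrow>
     (\<forall>p. complex_linear (T p)) \<and>
     T 1 = id_blinfun \<and>
     (\<forall>p q. T (p * q) = T p o\<^sub>L T q) \<and>
     (\<forall>p. norm (T p) \<le> 1)"

definition dilation_kernel ::
    "('p::monoid_mult \<Rightarrow> 'h::complex_hilbert_space \<Rightarrow>\<^sub>L 'h) \<Rightarrow> 'p \<Rightarrow> 'p \<Rightarrow> ('h \<Rightarrow>\<^sub>L 'h)" where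
  "dilation_kernel T p q =
     (if lcms {p, q} = {} then 0
      else let s = (SOME s. s \<in> lcms {p, q})
           in T (left_quotient p s) o\<^sub>L adjoint_op (T (left_quotient q s)))"

text \<open>
  Positivity of the operator matrix \<open>[K (p i) (p j)]\<close>, \<open>i, j < n\<close>, on the direct sum of \<open>n\<close> copies of
  the Hilbert space, with an arbitrary vector of that sum given as \<open>h 0, \<dots>, h (n - 1)\<close>.
\<close>

definition completely_positive_definite ::
    "('p \<Rightarrow> 'p \<Rightarrow> ('h::complex_hilbert_space \<Rightarrow>\<^sub>L 'h)) \<Rightarrow> bool" where
  "completely_positive_definite K \<longleftrightarrow>
     (\<forall>(n::nat) (p :: nat \<Rightarrow> 'p) (h :: nat \<Rightarrow> 'h).
        (\<Sum>i<n. cinner (\<Sum>j<n. K (p i) (p j) (h j)) (h i)) \<in> \<real>\<^sub>\<ge>\<^sub>0)"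

definition has_star_regular_dilation ::
    "('p::monoid_mult \<Rightarrow> 'h::complex_hilbert_space \<Rightarrow>\<^sub>L 'h) \<Rightarrow> bool" where
  "has_star_regular_dilation T \<longleftrightarrow> completely_positive_definite (dilation_kernel T)"

definition TT_adj ::
    "('p::monoid_mult \<Rightarrow> 'h::complex_hilbert_space \<Rightarrow>\<^sub>L 'h) \<Rightarrow> 'p \<Rightarrow> ('h \<Rightarrow>\<^sub>L 'h)" where
  "TT_adj T p = T p o\<^sub>L adjoint_op (T p)"

definition TT_adj_lcm ::
    "('p::monoid_mult \<Rightarrow> 'h::complex_hilbert_space \<Rightarrow>\<^sub>L 'h) \<Rightarrow> 'p set \<Rightarrow> ('h \<Rightarrow>\<^sub>L 'h)" where
  "TT_adj_lcm T U =
     (if U = {} then id_blinfun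
      else if lcms U = {} then 0
      else TT_adj T (SOME r. r \<in> lcms U))"

definition Z_op ::
    "('p::monoid_mult \<Rightarrow> 'h::complex_hilbert_space \<Rightarrow>\<^sub>L 'h) \<Rightarrow> 'p set \<Rightarrow> ('h \<Rightarrow>\<^sub>L 'h)" where
  "Z_op T F = (\<Sum>U\<in>Pow F. (-1) ^ card U *\<^sub>R TT_adj_lcm T U)"

section \<open>Thompson's monoid\<close>

text \<open>
  The word \<open>[i\<^sub>1, \<dots>, i\<^sub>m]\<close> stands for the product of the generators with indices
  \<open>i\<^sub>1, \<dots>, i\<^sub>m\<close>; the monoid is the quotient of the free monoid of words by the congruence
  generated by the defining relations.
\<close>

inductive thompson_step :: "nat list \<Rightarrow> nat list \<Rightarrow> bool" where
  "k < n \<Longrightarrow> thompson_step (u @ [n, k] @ v) (u @ [k, n + 1] @ v)"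

lemma thompson_step_append:
  "thompson_step a b \<Longrightarrow> thompson_step (u @ a @ v) (u @ b @ v)"
  by (induction rule: thompson_step.induct)
    (metis append.assoc thompson_step.intros)

lemma equivclp_thompson_step_append:
  assumes "equivclp thompson_step a b"
  shows "equivclp thompson_step (u @ a @ v) (u @ b @ v)"
  using assms
proof (induction rule: equivclp_induct)
  case base
  show ?case by simp
next
  case (step y z)
  from step(2) have "thompson_step (u @ y @ v) (u @ z @ v) \<or> thompson_step (u @ z @ v) (u @ y @ v)"
    using thompson_step_append by blast
  then show ?case
    using step.IH by (meson equivclp_into_equivclp)
qed

quotient_type thompson = "nat list" / "equivclp thompson_step"
  by (rule equivp_evquivclp)

instantiation thompson :: monoid_mult
begin

lift_definition one_thompson :: thompson is "[]" .

lift_definition times_thompson :: "thompson \<Rightarrow> thompson \<Rightarrow> thompson" is "(@)"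
  by (metis equivclp_thompson_step_append append_Nil append_Nil2 equivclp_trans)

instance
  by standard (transfer; simp)+

end

lift_definition thompson_gen :: "nat \<Rightarrow> thompson" is "\<lambda>n. [n]" .

lemma thompson_gen_relation:
  "k < n \<Longrightarrow> thompson_gen n * thompson_gen k = thompson_gen k * thompson_gen (n + 1)"
  by transfer (use thompson_step.intros[of _ _ "[]" "[]"] in \<open>auto intro: r_into_equivclp\<close>)

end

theory Submission
  imports Defs
begin

text \<open>
  The residual \<open>p\<^sup>-\<^sup>1(p \<squnion> q)\<close> of a generator \<open>q\<close> of Thompson's monoid by a generator \<open>p\<close> is
  a generator or trivial, so least common multiples exist and residuation never increases length.
  This is all that is used of the monoid.

  One has
  \<open>Z({p q} \<union> F) = Z({p} \<union> F) + T(p) Z({q} \<union> p\<^sup>-\<^sup>1(p \<squnion> F)) T(p)\<^sup>*\<close>. Both terms on the right have a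
  smaller total length of entries, so positivity of \<open>Z\<close> on sets of generators spreads to all finite
  sets. The quadratic form of the kernel at points \<open>p\<^sub>1, \<dots>, p\<^sub>n\<close>, compressed by the complements of
  the ranges belonging to a list \<open>xs\<close>, splits in the same manner: with \<open>x = p\<^sub>1\<close>, the part off the
  range of \<open>x\<close> no longer sees \<open>p\<^sub>1\<close>, and the part in the range of \<open>x\<close> is a form of the same kind
  at the residuals by \<open>x\<close>, where \<open>p\<^sub>1\<close> has become trivial. When all points are trivial, the form is
  that of a \<open>Z\<close>.
\<close>

section \<open>Adjoints\<close>

lemma cinner_add_right: "cinner x (y + z) = cinner x y + cinner x (z::'h::complex_hilbert_space)"
  by (metis cinner_add_left cinner_commute complex_cnj_add)

lemma cinner_scaleC_right: "cinner x (a *\<^sub>C y) = cnj a * cinner x (y::'h::complex_hilbert_space)"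
  by (metis cinner_scaleC_left cinner_commute complex_cnj_mult)

lemma cinner_scaleR_left: "cinner (r *\<^sub>R x) y = of_real r * cinner x (y::'h::complex_hilbert_space)"
  by (simp add: scaleR_scaleC cinner_scaleC_left)

lemma cinner_scaleR_right: "cinner x (r *\<^sub>R y) = of_real r * cinner x (y::'h::complex_hilbert_space)"
  by (simp add: scaleR_scaleC cinner_scaleC_right)

lemma cinner_zero_left [simp]: "cinner 0 (x::'h::complex_hilbert_space) = 0"
  using cinner_scaleR_left[of 0 0 x] by simp

lemma cinner_zero_right [simp]: "cinner (x::'h::complex_hilbert_space) 0 = 0"
  using cinner_scaleR_right[of x 0 0] by simp

lemma cinner_minus_left: "cinner (- x) y = - cinner x (y::'h::complex_hilbert_space)"
  using cinner_scaleR_left[of "-1" x y] by simp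

lemma cinner_minus_right: "cinner x (- y) = - cinner x (y::'h::complex_hilbert_space)"
  using cinner_scaleR_right[of x "-1" y] by simp

lemma cinner_diff_right: "cinner x (y - z) = cinner x y - cinner x (z::'h::complex_hilbert_space)"
  using cinner_add_right[of x y "- z"] by (simp add: cinner_minus_right)

lemma cinner_sum_left: "cinner (\<Sum>i\<in>I. f i) y = (\<Sum>i\<in>I. cinner (f i) (y::'h::complex_hilbert_space))"
  by (induction I rule: infinite_finite_induct) (auto simp: cinner_add_left)

lemma cinner_sum_right: "cinner y (\<Sum>i\<in>I. f i) = (\<Sum>i\<in>I. cinner (y::'h::complex_hilbert_space) (f i))"
  by (induction I rule: infinite_finite_induct) (auto simp: cinner_add_right)

lemma norm_add_square:
  "(norm (x + y))\<^sup>2 = (norm x)\<^sup>2 + 2 * Re (cinner x y) + (norm (y::'h::complex_hilbert_space))\<^sup>2"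
proof -
  have "complex_of_real ((norm (x + y))\<^sup>2) = cinner x x + cinner x y + cnj (cinner x y) + cinner y y"
    unfolding cinner_self[symmetric] cinner_commute[of x y, symmetric]
    by (metis (no_types, lifting) add.assoc cinner_add_left cinner_add_right cinner_commute)
  then have "Re (complex_of_real ((norm (x + y))\<^sup>2))
      = Re (cinner x x + cinner x y + cnj (cinner x y) + cinner y y)"
    by simp
  then show ?thesis
    by (simp add: cinner_self del: of_real_power)
qed

text \<open>Cauchy-Schwarz, by squaring the triangle inequality of the given norm.\<close>

lemma Re_cinner_le: "Re (cinner x y) \<le> norm x * norm (y::'h::complex_hilbert_space)"
proof -
  have "(norm (x + y))\<^sup>2 \<le> (norm x + norm y)\<^sup>2"
    by (simp add: norm_triangle_ineq power_mono)
  then show ?thesis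
    by (simp add: norm_add_square power2_sum)
qed

lemma parallelogram:
  "(norm (x + y))\<^sup>2 + (norm (x - y))\<^sup>2 = 2 * (norm x)\<^sup>2 + 2 * (norm (y::'h::complex_hilbert_space))\<^sup>2"
  using norm_add_square[of x y] norm_add_square[of x "- y"] by (simp add: cinner_minus_right)

lemma cinner_eqI:
  fixes x y :: "'h::complex_hilbert_space"
  assumes "\<And>z. cinner z x = cinner z y"
  shows "x = y"
proof -
  have "complex_of_real ((norm (x - y))\<^sup>2) = cinner (x - y) (x - y)"
    by (simp add: cinner_self)
  also have "\<dots> = 0"
    by (simp add: cinner_diff_right assms)
  finally show ?thesis by (simp del: of_real_power)
qed

text \<open>The representing vector minimises \<open>\<parallel>x\<parallel>\<^sup>2 - 2 f x\<close>.\<close>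

lemma riesz_real:
  fixes f :: "'h::complex_hilbert_space \<Rightarrow> real"
  assumes "bounded_linear f"
  obtains v where "\<And>x. f x = Re (cinner x v)"
proof -
  interpret f: bounded_linear f by fact
  define J where "J x = (norm x)\<^sup>2 - 2 * f x" for x
  obtain C where C: "\<And>x. \<bar>f x\<bar> \<le> norm x * C"
    using f.bounded by (auto simp: real_norm_def)
  have lower: "- C\<^sup>2 \<le> J x" for x
  proof -
    have "f x \<le> norm x * C" using C[of x] by linarith
    moreover have "0 \<le> (norm x - C)\<^sup>2" by simp
    ultimately show ?thesis
      by (simp add: J_def power2_diff)
  qed
  define m where "m = (INF x. J x)"
  have bdd: "bdd_below (range J)"
    using lower by (auto intro!: bdd_belowI)
  have m_le: "m \<le> J x" for x
    unfolding m_def by (rule cINF_lower[OF bdd]) simp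
  have "\<exists>x. J x < m + inverse (real (Suc n))" for n
    using cINF_less_iff[OF _ bdd, of "m + inverse (real (Suc n))"] by (auto simp: m_def)
  then obtain s where s: "\<And>n. J (s n) < m + inverse (real (Suc n))"
    by metis
  \<comment> \<open>The parallelogram law, in which the linear parts of \<open>J\<close> cancel. As
    midpoints have value at least \<open>m\<close>, near-minimisers lie close together.\<close>
  have J_mid: "(norm (x - y))\<^sup>2 = 2 * J x + 2 * J y - 4 * J ((1/2) *\<^sub>R (x + y))" for x y
  proof -
    have "(norm ((1/2) *\<^sub>R (x + y)))\<^sup>2 = (norm (x + y))\<^sup>2 / 4"
      by (simp add: power_divide)
    moreover have "f ((1/2) *\<^sub>R (x + y)) = (f x + f y) / 2"
      unfolding f.scaleR f.add by simp
    ultimately show ?thesis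
      using parallelogram[of x y] by (simp add: J_def)
  qed
  have close: "(norm (s i - s j))\<^sup>2 < 4 * inverse (real (Suc n))" if "n \<le> i" "n \<le> j" for i j n
  proof -
    have "inverse (real (Suc i)) \<le> inverse (real (Suc n))" "inverse (real (Suc j)) \<le> inverse (real (Suc n))"
      using that by (auto intro!: le_imp_inverse_le)
    then show ?thesis
      using J_mid[of "s i" "s j"] s[of i] s[of j] m_le[of "(1/2) *\<^sub>R (s i + s j)"] by linarith
  qed
  have "Cauchy s"
  proof (rule CauchyI)
    fix e :: real assume "0 < e"
    then obtain n where n: "inverse (real (Suc n)) < e\<^sup>2 / 4"
      using reals_Archimedean[of "e\<^sup>2 / 4"] by auto
    have "norm (s i - s j) < e" if "n \<le> i" "n \<le> j" for i j
      by (rule power_less_imp_less_base[of _ 2]) (use close[OF that] n \<open>0 < e\<close> in auto)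
    then show "\<exists>M. \<forall>m\<ge>M. \<forall>n\<ge>M. norm (s m - s n) < e" by blast
  qed
  then obtain v where v: "s \<longlonglongrightarrow> v"
    using Cauchy_convergent convergent_def by blast
  have "(\<lambda>n. J (s n)) \<longlonglongrightarrow> J v"
    unfolding J_def by (intro tendsto_intros f.tendsto v)
  moreover have "(\<lambda>n. m + inverse (real (Suc n))) \<longlonglongrightarrow> m + 0"
    by (intro tendsto_intros LIMSEQ_inverse_real_of_nat)
  ultimately have "J v \<le> m + 0"
    by (rule LIMSEQ_le) (use s less_imp_le in blast)
  then have min: "J v \<le> J x" for x
    using m_le[of x] by simp
  have "f x = Re (cinner x v)" for x
  proof -
    define b where "b = Re (cinner v x) - f x"
    have quad: "0 \<le> 2 * t * b + t\<^sup>2 * (norm x)\<^sup>2" for t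
    proof -
      have "J (v + t *\<^sub>R x) = J v + 2 * t * b + t\<^sup>2 * (norm x)\<^sup>2"
        by (simp add: J_def b_def norm_add_square f.add f.scaleR cinner_scaleR_right
            power_mult_distrib algebra_simps)
      then show ?thesis using min[of "v + t *\<^sub>R x"] by simp
    qed
    have "b = 0"
    proof (cases "x = 0")
      case False
      \<comment> \<open>The quadratic in \<open>quad\<close> has its minimum at
        \<open>t = - b / N\<close>.\<close>
      define N where "N = (norm x)\<^sup>2"
      have "0 < N" using False by (simp add: N_def)
      then have "2 * (- b / N) * b + (- b / N)\<^sup>2 * N = - (b\<^sup>2 / N)"
        by (simp add: field_simps power2_eq_square)
      then have "b\<^sup>2 / N \<le> 0" using quad[of "- b / N"] by (simp add: N_def)
      then show ?thesis using \<open>0 < N\<close> by (simp add: divide_le_0_iff)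
    qed (simp add: b_def f.zero)
    moreover have "Re (cinner v x) = Re (cinner x v)"
      by (subst cinner_commute) simp
    ultimately show ?thesis by (simp add: b_def)
  qed
  then show ?thesis using that by blast
qed

text \<open>For each \<open>y\<close>, the Riesz vector of the real functional
  \<open>Re (cinner (A x) y)\<close> of \<open>x\<close> serves as \<open>B y\<close>.\<close>

lemma adjoint_exists:
  fixes A :: "'h::complex_hilbert_space \<Rightarrow>\<^sub>L 'h"
  assumes "complex_linear A"
  shows "\<exists>B :: 'h \<Rightarrow>\<^sub>L 'h. \<forall>x y. cinner (A x) y = cinner x (B y)"
proof -
  have "bounded_linear (\<lambda>x. Re (cinner (A x) y))" for y
  proof (rule bounded_linear_intro[where K = "norm A * norm y"])
    fix x
    have "Re (cinner (A x) y) \<le> norm (A x) * norm y" "- Re (cinner (A x) y) \<le> norm (A x) * norm y"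
      using Re_cinner_le[of "A x" y] Re_cinner_le[of "- A x" y] by (auto simp: cinner_minus_left)
    then have "\<bar>Re (cinner (A x) y)\<bar> \<le> norm (A x) * norm y" by linarith
    also have "\<dots> \<le> (norm A * norm x) * norm y"
      by (intro mult_right_mono norm_blinfun) simp
    finally show "norm (Re (cinner (A x) y)) \<le> norm x * (norm A * norm y)"
      by (simp add: ac_simps)
  qed (auto simp: blinfun.add_right blinfun.scaleR_right cinner_add_left cinner_scaleR_left)
  then have "\<exists>v. \<forall>x. Re (cinner (A x) y) = Re (cinner x v)" for y
    using riesz_real by metis
  then obtain B where B: "\<And>x y. Re (cinner (A x) y) = Re (cinner x (B y))"
    by metis
  have adj: "cinner (A x) y = cinner x (B y)" for x y
  proof (rule complex_eqI)
    \<comment> \<open>Multiplying \<open>x\<close> by \<open>\<i>\<close> exchanges real and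
      imaginary parts up to sign; complex linearity of \<open>A\<close> enters here.\<close>
    have "Re (cinner (A (\<i> *\<^sub>C x)) y) = Re (cinner (\<i> *\<^sub>C x) (B y))" by (rule B)
    then show "Im (cinner (A x) y) = Im (cinner x (B y))"
      using assms by (simp add: complex_linear_def cinner_scaleC_left)
  qed (rule B)
  have "bounded_linear B"
  proof (rule bounded_linear_intro[where K = "norm A"])
    show "B (x + y) = B x + B y" for x y
      by (rule cinner_eqI) (simp add: adj[symmetric] cinner_add_right)
    show "B (r *\<^sub>R x) = r *\<^sub>R B x" for r x
      by (rule cinner_eqI) (simp add: adj[symmetric] cinner_scaleR_right)
    show "norm (B y) \<le> norm y * norm A" for y
    proof (cases "B y = 0")
      case False
      have "(norm (B y))\<^sup>2 = Re (cinner (A (B y)) y)"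
        by (simp add: adj cinner_self del: of_real_power)
      also have "\<dots> \<le> norm (A (B y)) * norm y" by (rule Re_cinner_le)
      also have "\<dots> \<le> (norm A * norm (B y)) * norm y"
        by (intro mult_right_mono norm_blinfun) simp
      finally have "norm (B y) * norm (B y) \<le> norm (B y) * (norm y * norm A)"
        by (simp add: power2_eq_square ac_simps)
      then show ?thesis using False by simp
    qed simp
  qed
  then show ?thesis
    using adj by (intro exI[of _ "Blinfun B"]) (simp add: bounded_linear_Blinfun_apply)
qed

lemma adjoint_unique:
  fixes A B :: "'h::complex_hilbert_space \<Rightarrow>\<^sub>L 'h"
  assumes "\<And>x y. cinner (A x) y = cinner x (B y)"
  shows "adjoint_op A = B"
  unfolding adjoint_op_def
proof (rule the_equality)
  fix B' :: "'h \<Rightarrow>\<^sub>L 'h"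
  assume "\<forall>x y. cinner (A x) y = cinner x (B' y)"
  then show "B' = B"
    using assms by (intro blinfun_eqI cinner_eqI) metis
qed (use assms in blast)

lemma cinner_adjoint:
  fixes A :: "'h::complex_hilbert_space \<Rightarrow>\<^sub>L 'h"
  assumes "complex_linear A"
  shows "cinner (A x) y = cinner x (adjoint_op A y)"
  using adjoint_exists[OF assms] adjoint_unique by metis

lemma adjoint_id: "adjoint_op id_blinfun = (id_blinfun :: 'h::complex_hilbert_space \<Rightarrow>\<^sub>L 'h)"
  by (rule adjoint_unique) simp

lemma adjoint_compose:
  fixes A B :: "'h::complex_hilbert_space \<Rightarrow>\<^sub>L 'h"
  assumes "complex_linear A" "complex_linear B"
  shows "adjoint_op (A o\<^sub>L B) = adjoint_op B o\<^sub>L adjoint_op A"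
  by (rule adjoint_unique) (simp add: cinner_adjoint assms)

lemma right_ideal_mult: "right_ideal (p * q) = (\<lambda>t. p * t) ` right_ideal q"
  by (auto simp: right_ideal_def mult.assoc)

section \<open>Graded monoids with least common multiples\<close>

text \<open>The length bound on common multiples is what keeps residuals from growing, so that
  inductions on total length go through.\<close>

locale graded_lcm_monoid =
  fixes len :: "'p::monoid_mult \<Rightarrow> nat"
  assumes len_mult: "len (p * q) = len p + len q"
    and len_eq_0: "len p = 0 \<Longrightarrow> p = 1"
    and left_cancel: "p * q = p * r \<Longrightarrow> q = r"
    and lcm_exists: "\<exists>s. right_ideal p \<inter> right_ideal q = right_ideal s \<and> len s \<le> len p + len q"
begin

text \<open>The same choice as in \<open>dilation_kernel\<close>; by \<open>lcms_pair\<close> there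
  is only one candidate.\<close>

definition join :: "'p \<Rightarrow> 'p \<Rightarrow> 'p" (infixl \<open>\<squnion>\<close> 65) where
  "p \<squnion> q = (SOME s. s \<in> lcms {p, q})"

definition res :: "'p \<Rightarrow> 'p \<Rightarrow> 'p" where
  "res p q = left_quotient p (p \<squnion> q)"

lemma len_pos: "p \<noteq> 1 \<Longrightarrow> 0 < len p"
  using len_eq_0 by blast

text \<open>If \<open>p = q * u\<close> and \<open>q = p * v\<close>, then \<open>u\<close> has
  length 0. Hence identities between joins can be checked on ideals.\<close>

lemma right_ideal_inject: "right_ideal p = right_ideal q \<longleftrightarrow> p = (q :: 'p)"
proof
  assume eq: "right_ideal p = right_ideal q"
  have "p \<in> right_ideal p" "q \<in> right_ideal q"
    by (metis mult.right_neutral rangeI right_ideal_def)+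
  then obtain u v where "p = q * u" "q = p * v"
    unfolding eq by (metis eq imageE right_ideal_def)
  then have "u = 1"
    using len_mult[of q u] len_mult[of p v] by (intro len_eq_0) simp
  with \<open>p = q * u\<close> show "p = q" by simp
qed simp

lemma lcms_eqI: "(\<Inter>x\<in>U. right_ideal x) = right_ideal r \<Longrightarrow> lcms U = {r :: 'p}"
  by (auto simp: lcms_def right_ideal_inject)

lemma lcms_pair: "lcms {p, q} = {p \<squnion> q}"
  using lcms_eqI[of "{p, q}"] lcm_exists[of p q] by (auto simp: join_def)

lemma right_ideal_join: "right_ideal (p \<squnion> q) = right_ideal p \<inter> right_ideal q"
proof -
  have "p \<squnion> q \<in> lcms {p, q}" by (simp add: lcms_pair)
  then show ?thesis by (simp add: lcms_def)
qed

lemma len_join: "len (p \<squnion> q) \<le> len p + len q"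
  using lcm_exists[of p q] right_ideal_join[of p q] right_ideal_inject by metis

sublocale join: semilattice join
  by standard (auto simp: right_ideal_join right_ideal_inject[symmetric])

lemma right_ideal_1 [simp]: "right_ideal (1 :: 'p) = UNIV"
  by (auto simp: right_ideal_def)

lemma join_1_left [simp]: "1 \<squnion> p = p"
  by (auto simp: right_ideal_join right_ideal_inject[symmetric])

lemma join_1_right [simp]: "p \<squnion> 1 = p"
  by (auto simp: right_ideal_join right_ideal_inject[symmetric])

lemma mult_join: "p * (q \<squnion> r) = p * q \<squnion> p * r"
proof -
  have "right_ideal (p * (q \<squnion> r)) = right_ideal (p * q) \<inter> right_ideal (p * r)"
    unfolding right_ideal_mult right_ideal_join
    by (rule image_Int) (auto intro: injI left_cancel)
  then show ?thesis by (simp add: right_ideal_join right_ideal_inject[symmetric])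
qed

lemma join_mult_self: "p \<squnion> p * q = p * q"
  using mult_join[of p 1 q] by simp

lemma mult_res: "p * res p q = p \<squnion> q"
proof -
  have "p \<squnion> q \<in> right_ideal (p \<squnion> q)"
    by (metis mult.right_neutral rangeI right_ideal_def)
  then obtain t where "p * t = p \<squnion> q"
    unfolding right_ideal_join by (auto simp: right_ideal_def)
  then show ?thesis
    unfolding res_def left_quotient_def
    by (rule theI) (use \<open>p * t = p \<squnion> q\<close> left_cancel in metis)
qed

lemma res_eqI: "p * t = p \<squnion> q \<Longrightarrow> res p q = t"
  using mult_res left_cancel by metis

lemma len_res: "len (res p q) \<le> len q"
  using len_join[of p q] len_mult[of p "res p q"] by (simp add: mult_res)

lemma res_self [simp]: "res p p = 1"
  by (rule res_eqI) simp

lemma res_1_left [simp]: "res 1 p = p"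
  by (rule res_eqI) simp

lemma res_join: "res p (p \<squnion> q) = res p q"
  by (rule res_eqI) (simp add: mult_res)

text \<open>Two lcm squares are pasted together: \<open>p\<close> is moved past \<open>q\<close>,
  and what remains of it, \<open>res q p\<close>, past \<open>r\<close>.\<close>

lemma res_mult_right: "res p (q * r) = res p q * res (res q p) r"
proof (rule res_eqI)
  have "p * (res p q * res (res q p) r) = q * (res q p * res (res q p) r)"
    by (metis mult.assoc mult_res join.commute)
  also have "\<dots> = q * res q p \<squnion> q * r"
    by (simp add: mult_res mult_join)
  also have "\<dots> = p \<squnion> (q \<squnion> q * r)"
    by (simp add: mult_res ac_simps)
  finally show "p * (res p q * res (res q p) r) = p \<squnion> q * r"
    by (simp add: join_mult_self)
qed

lemma mult_join_res: "x * r \<squnion> y = x * (r \<squnion> res x y)"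
proof -
  have "x * (r \<squnion> res x y) = x \<squnion> x * r \<squnion> y"
    by (simp add: mult_join mult_res ac_simps)
  then show ?thesis by (simp add: join_mult_self)
qed

lemma join_eq_mult_res_join: "p \<squnion> q \<squnion> x = x * (res x p \<squnion> res x q)"
  by (simp add: mult_join mult_res ac_simps)

section \<open>Finite joins and inclusion-exclusion\<close>

definition Join :: "'p set \<Rightarrow> 'p" where
  "Join U = (SOME r. r \<in> lcms U)"

lemma Join_empty [simp]: "Join {} = 1"
  using lcms_eqI[of "{}" 1] by (simp add: Join_def)

lemma lcms_finite: "finite U \<Longrightarrow> lcms U = {Join U}"
proof (induction rule: finite_induct)
  case empty
  then show ?case using lcms_eqI[of "{}" 1] by simp
next
  case (insert x U)
  then have "Join U \<in> lcms U" by blast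
  then have "lcms (insert x U) = {x \<squnion> Join U}"
    by (intro lcms_eqI) (simp add: lcms_def right_ideal_join)
  then show ?case by (simp add: Join_def)
qed

lemma Join_insert:
  assumes "finite U"
  shows "Join (insert x U) = x \<squnion> Join U"
proof -
  have "Join U \<in> lcms U" using assms lcms_finite by blast
  then have "lcms (insert x U) = {x \<squnion> Join U}"
    by (intro lcms_eqI) (simp add: lcms_def right_ideal_join)
  then show ?thesis by (simp add: Join_def)
qed

text \<open>Inclusion-exclusion over the joins of subsets, based at \<open>r\<close>. Lists allow
  entries to be split off one at a time; order and repetitions turn out not to matter.\<close>

primrec excl :: "('p \<Rightarrow> 'a::ab_group_add) \<Rightarrow> 'p \<Rightarrow> 'p list \<Rightarrow> 'a" where
  "excl a r [] = a r"
| "excl a r (x # xs) = excl a r xs - excl a (r \<squnion> x) xs"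

lemma excl_append_Cons:
  "excl a r (xs @ x # ys) = excl a r (xs @ ys) - excl a (r \<squnion> x) (xs @ ys)"
  by (induction xs arbitrary: r) (auto simp: ac_simps)

text \<open>Once \<open>x\<close> is split off, the two terms of the difference coincide.\<close>

lemma excl_eq_0:
  assumes "x \<in> set xs" "r \<squnion> x = r"
  shows "excl a r xs = 0"
  using split_list[OF assms(1)] assms(2) by (auto simp: excl_append_Cons)

text \<open>By \<open>mult_join_res\<close> the factor \<open>x\<close> can be pulled out of every
  join.\<close>

lemma excl_mult: "excl a (x * r) xs = excl (\<lambda>t. a (x * t)) r (map (res x) xs)"
  by (induction xs arbitrary: r) (auto simp: mult_join_res)

lemma excl_sum: "excl (\<lambda>s. \<Sum>i\<in>I. f i s) r xs = (\<Sum>i\<in>I. excl (f i) r xs)"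
  by (induction xs arbitrary: r) (auto simp: sum_subtractf)

lemma excl_eq_sum_subsets:
  fixes a :: "'p \<Rightarrow> 'a::real_vector"
  shows "excl a r xs = (\<Sum>U\<in>Pow (set xs). (-1) ^ card U *\<^sub>R a (r \<squnion> Join U))"
proof (induction xs arbitrary: r)
  case (Cons x xs)
  show ?case
  proof (cases "x \<in> set xs")
    case True
    \<comment> \<open>A repeated entry leaves the set unchanged, and the subtracted term
      vanishes.\<close>
    then have "excl a (r \<squnion> x) xs = 0" by (intro excl_eq_0) auto
    with True show ?thesis by (simp add: Cons.IH insert_absorb)
  next
    case False
    have inj: "inj_on (insert x) (Pow (set xs))"
      using False by (auto simp: inj_on_def)
    have disj: "Pow (set xs) \<inter> insert x ` Pow (set xs) = {}"
      using False by auto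
    have fin: "finite U" "x \<notin> U" if "U \<in> Pow (set xs)" for U
      using that False finite_subset by auto
    have "(\<Sum>U\<in>insert x ` Pow (set xs). (-1) ^ card U *\<^sub>R a (r \<squnion> Join U))
        = (\<Sum>U\<in>Pow (set xs). - ((-1) ^ card U *\<^sub>R a (r \<squnion> x \<squnion> Join U)))"
      unfolding sum.reindex[OF inj] using fin
      by (intro sum.cong) (auto simp: Join_insert ac_simps)
    then show ?thesis
      by (simp add: Pow_insert sum.union_disjoint disj Cons.IH sum_negf)
  qed
qed simp

end

section \<open>Positivity of the dilation kernel\<close>

locale graded_lcm_representation = graded_lcm_monoid len
  for len :: "'p::monoid_mult \<Rightarrow> nat" +
  fixes T :: "'p \<Rightarrow> 'h::complex_hilbert_space \<Rightarrow>\<^sub>L 'h"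
  assumes rep: "contractive_representation T"
begin

section \<open>Quadratic forms of the operators and of the kernel\<close>

lemma complex_linear_T: "complex_linear (T p)"
  using rep by (simp add: contractive_representation_def)

definition coact :: "'p \<Rightarrow> 'h \<Rightarrow> 'h" where
  "coact p h = adjoint_op (T p) h"

lemma cinner_T: "cinner (T p x) y = cinner x (coact p y)"
  by (simp add: coact_def cinner_adjoint complex_linear_T)

lemma coact_1 [simp]: "coact 1 h = h"
  using rep by (simp add: coact_def contractive_representation_def adjoint_id)

lemma coact_mult: "coact (p * q) h = coact q (coact p h)"
  using rep complex_linear_T
  by (simp add: coact_def contractive_representation_def adjoint_compose)

lemma coact_sum: "coact p (\<Sum>i\<in>I. f i) = (\<Sum>i\<in>I. coact p (f i))"
  by (simp add: coact_def blinfun.sum_right)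

lemma coact_scaleR: "coact p (c *\<^sub>R h) = c *\<^sub>R coact p h"
  by (simp add: coact_def blinfun.scaleR_right)

lemma coact_res: "coact (res p q) (coact p h) = coact (p \<squnion> q) h"
  by (simp add: coact_mult[symmetric] mult_res)

text \<open>The quadratic form of \<open>TT_adj T s\<close> at \<open>h\<close>.\<close>

definition qform :: "'h \<Rightarrow> 'p \<Rightarrow> complex" where
  "qform h s = cinner (coact s h) (coact s h)"

text \<open>A kernel entry with the least common multiple replaced by a variable \<open>s\<close>.
  If \<open>s\<close> is a multiple of \<open>p\<close>, then \<open>res p s\<close> is the quotient
  of \<open>s\<close> by \<open>p\<close>; using \<open>res\<close> makes the formula total.\<close>

definition gram :: "'p \<Rightarrow> 'h \<Rightarrow> 'p \<Rightarrow> 'h \<Rightarrow> 'p \<Rightarrow> complex" where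
  "gram p h q g s = cinner (coact (res q s) g) (coact (res p s) h)"

lemma cinner_dilation_kernel:
  "cinner (dilation_kernel T p q g) h = gram p h q g (p \<squnion> q)"
proof -
  have "dilation_kernel T p q = T (res p q) o\<^sub>L adjoint_op (T (res q p))"
    by (simp add: dilation_kernel_def lcms_pair res_def join.commute Let_def)
  moreover have "res q (p \<squnion> q) = res q p"
    by (metis join.commute res_join)
  ultimately show ?thesis
    by (simp add: gram_def res_join coact_def cinner_adjoint complex_linear_T)
qed

lemma cinner_Z_op:
  assumes "finite F"
  shows "cinner (Z_op T F h) h = (\<Sum>U\<in>Pow F. (-1) ^ card U *\<^sub>R qform h (Join U))"
proof -
  have "cinner (TT_adj_lcm T U h) h = qform h (Join U)" if "U \<in> Pow F" for U
  proof -
    have "finite U" using that assms finite_subset by auto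
    \<comment> \<open>For empty \<open>U\<close> the default \<open>id_blinfun\<close> agrees with
      the value at \<open>Join {} = 1\<close>.\<close>
    then have "TT_adj_lcm T U = TT_adj T (Join U)"
      using rep by (auto simp: TT_adj_lcm_def lcms_finite TT_adj_def contractive_representation_def
          adjoint_id intro: blinfun_eqI)
    then show ?thesis
      by (simp add: TT_adj_def qform_def cinner_T coact_def)
  qed
  then show ?thesis
    by (simp add: Z_op_def blinfun.sum_left blinfun.scaleR_left cinner_sum_left cinner_scaleR_left
        scaleR_conv_of_real del: of_real_power)
qed

corollary positive_Z_op_iff:
  "positive_op (Z_op T (set xs)) \<longleftrightarrow> (\<forall>h. excl (qform h) 1 xs \<in> \<real>\<^sub>\<ge>\<^sub>0)"
  by (simp add: positive_op_def cinner_Z_op excl_eq_sum_subsets)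

subsection \<open>Necessity\<close>

text \<open>
  The vectors \<open>\<plusminus> T(\<Or>U)\<^sup>* h\<close> at the points \<open>\<Or>U\<close>; on them the kernel takes the value
  \<open>\<langle>Z(F) h, h\<rangle>\<close>.
\<close>

primrec signed_vectors :: "'h \<Rightarrow> real \<Rightarrow> 'p \<Rightarrow> 'p list \<Rightarrow> ('p \<times> 'h) list" where
  "signed_vectors h c r [] = [(r, c *\<^sub>R coact r h)]"
| "signed_vectors h c r (x # xs) = signed_vectors h c r xs @ signed_vectors h (- c) (r \<squnion> x) xs"

text \<open>By \<open>coact_res\<close> an entry depends only on the join of its two points. Of the
  four blocks for \<open>x # xs\<close>, the three involving \<open>x\<close> share the base
  \<open>r \<squnion> s \<squnion> x\<close> and carry signs -, -, +, which leaves the subtracted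
  term of \<open>excl\<close>.\<close>

lemma kernel_signed_vectors:
  "(\<Sum>(p, g)\<leftarrow>signed_vectors h c r xs. \<Sum>(q, f)\<leftarrow>signed_vectors h d s xs.
      cinner (dilation_kernel T p q f) g) = of_real (c * d) * excl (qform h) (r \<squnion> s) xs"
proof (induction xs arbitrary: c r d s)
  case Nil
  have "coact (res r (r \<squnion> s)) (coact r h) = coact (r \<squnion> s) h"
    "coact (res s (r \<squnion> s)) (coact s h) = coact (r \<squnion> s) h"
    by (simp_all add: coact_res join.left_commute)
  then show ?case
    by (simp add: cinner_dilation_kernel gram_def qform_def coact_scaleR
        cinner_scaleR_left cinner_scaleR_right)
next
  case (Cons x xs)
  have idem: "r \<squnion> x \<squnion> s = r \<squnion> s \<squnion> x" "r \<squnion> (s \<squnion> x) = r \<squnion> s \<squnion> x"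
    "r \<squnion> x \<squnion> (s \<squnion> x) = r \<squnion> s \<squnion> x"
    by (simp_all add: ac_simps)
  show ?case
    by (simp add: case_prod_unfold sum_list_addf Cons.IH[unfolded case_prod_unfold] idem)
       (simp add: algebra_simps)
qed

lemma dilation_imp_excl_nonneg:
  assumes "has_star_regular_dilation T"
  shows "excl (qform h) 1 xs \<in> \<real>\<^sub>\<ge>\<^sub>0"
proof -
  define D where "D = signed_vectors h 1 1 xs"
  have "(\<Sum>i<length D. cinner (\<Sum>j<length D.
      dilation_kernel T (fst (D ! i)) (fst (D ! j)) (snd (D ! j))) (snd (D ! i))) \<in> \<real>\<^sub>\<ge>\<^sub>0"
    using assms[unfolded has_star_regular_dilation_def completely_positive_definite_def, rule_format,
        where n = "length D" and p = "\<lambda>i. fst (D ! i)" and h = "\<lambda>i. snd (D ! i)"] .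
  moreover have "excl (qform h) 1 xs = (\<Sum>(p, g)\<leftarrow>D. \<Sum>(q, f)\<leftarrow>D. cinner (dilation_kernel T p q f) g)"
    using kernel_signed_vectors[of h 1 1 xs 1 1] by (simp add: D_def)
  ultimately show ?thesis
    by (simp add: cinner_sum_left sum_list_sum_nth case_prod_unfold atLeast0LessThan)
qed

subsection \<open>Sufficiency\<close>

lemma excl_qform_mult: "excl (qform h) (p * r) xs = excl (qform (coact p h)) r (map (res p) xs)"
  by (simp add: excl_mult qform_def[abs_def] coact_mult)

lemma sum_list_len_res: "sum_list (map len (map (res p) xs)) \<le> sum_list (map len xs)"
  by (induction xs) (simp_all add: add_mono len_res)

text \<open>A decomposable entry \<open>p * q\<close> becomes \<open>p\<close> in one term and
  \<open>q\<close> in the other, where the remaining entries are residuated by \<open>p\<close>; the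
  total length drops in both.\<close>

lemma excl_nonneg_of_atoms:
  assumes split: "\<And>p. p \<noteq> 1 \<Longrightarrow> p \<notin> A \<Longrightarrow> \<exists>q r. q \<noteq> 1 \<and> r \<noteq> 1 \<and> p = q * r"
    and atoms: "\<And>h xs. set xs \<subseteq> A \<Longrightarrow> excl (qform h) 1 xs \<in> \<real>\<^sub>\<ge>\<^sub>0"
  shows "excl (qform h) 1 xs \<in> \<real>\<^sub>\<ge>\<^sub>0"
proof (induction "sum_list (map len xs)" arbitrary: h xs rule: less_induct)
  case less
  show ?case
  proof (cases "1 \<in> set xs \<or> set xs \<subseteq> A")
    case True
    then show ?thesis
    proof
      assume "1 \<in> set xs"
      then have "excl (qform h) 1 xs = 0" by (rule excl_eq_0) simp
      then show ?thesis by simp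
    qed (rule atoms)
  next
    case False
    then obtain x where "x \<in> set xs" "x \<noteq> 1" "x \<notin> A" by auto
    then obtain p q ys zs where pq: "p \<noteq> 1" "q \<noteq> 1" and xs: "xs = ys @ (p * q) # zs"
      using split[of x] split_list[of x xs] by blast
    let ?l = "ys @ zs"
    \<comment> \<open>The value based at \<open>p\<close> is subtracted and added; writing it as
      \<open>p * 1\<close> lets \<open>p\<close> be pulled out of the bracket.\<close>
    have "excl (qform h) 1 xs = excl (qform h) 1 (p # ?l)
        + (excl (qform h) (p * 1) ?l - excl (qform h) (p * q) ?l)"
      by (simp add: xs excl_append_Cons)
    also have "\<dots> = excl (qform h) 1 (p # ?l) + excl (qform (coact p h)) 1 (q # map (res p) ?l)"
      unfolding excl_qform_mult by simp
    also have "\<dots> \<in> \<real>\<^sub>\<ge>\<^sub>0"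
      using pq[THEN len_pos] sum_list_len_res[of p ?l]
      by (intro nonneg_Reals_add_I less) (simp_all add: xs len_mult)
    finally show ?thesis .
  qed
qed

text \<open>By \<open>res_mult_right\<close>, dividing the common multiple by \<open>x\<close> moves
  the points to their residuals and the vectors along with them.\<close>

lemma gram_mult:
  "gram p h q g (x * s) = gram (res x p) (coact (res p x) h) (res x q) (coact (res q x) g) s"
  by (simp add: gram_def res_mult_right coact_mult)

text \<open>
  For \<open>x = p i\<close> the first summand of the splitting
  \<open>excl a r xs = excl a r (x # xs) + excl a (r \<squnion> x) xs\<close> loses the index \<open>i\<close>, and in the
  second all points can be divided by \<open>x\<close>.
\<close>

lemma gram_nonneg:
  assumes pos: "\<And>h xs. excl (qform h) 1 xs \<in> \<real>\<^sub>\<ge>\<^sub>0"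
    and "finite I"
  shows "(\<Sum>i\<in>I. \<Sum>j\<in>I. excl (gram (p i) (h i) (p j) (h j)) (p i \<squnion> p j) xs) \<in> \<real>\<^sub>\<ge>\<^sub>0"
  using \<open>finite I\<close>
proof (induction "card I + (\<Sum>i\<in>I. len (p i))" arbitrary: I p h xs rule: less_induct)
  case less
  show ?case
  proof (cases "\<forall>i\<in>I. p i = 1")
    case True
    \<comment> \<open>At trivial points the double sum is the sesquilinear expansion of a single
      form at the sum of the vectors.\<close>
    have "qform (\<Sum>i\<in>I. h i) s = (\<Sum>i\<in>I. \<Sum>j\<in>I. gram 1 (h i) 1 (h j) s)" for s
      unfolding qform_def gram_def coact_sum cinner_sum_right
      by (simp add: cinner_sum_left)
    then have "qform (\<Sum>i\<in>I. h i) = (\<lambda>s. \<Sum>i\<in>I. \<Sum>j\<in>I. gram 1 (h i) 1 (h j) s)" ..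
    then have "excl (qform (\<Sum>i\<in>I. h i)) 1 xs
        = (\<Sum>i\<in>I. \<Sum>j\<in>I. excl (gram 1 (h i) 1 (h j)) 1 xs)"
      by (simp add: excl_sum)
    also have "\<dots> = (\<Sum>i\<in>I. \<Sum>j\<in>I. excl (gram (p i) (h i) (p j) (h j)) (p i \<squnion> p j) xs)"
      using True by simp
    finally show ?thesis using pos by metis
  next
    case False
    then obtain k where k: "k \<in> I" "p k \<noteq> 1" by blast
    let ?x = "p k"
    let ?p = "\<lambda>i. res ?x (p i)" and ?h = "\<lambda>i. coact (res (p i) ?x) (h i)"
    let ?a = "\<lambda>i j. gram (p i) (h i) (p j) (h j)"
    have "excl (?a i j) (p i \<squnion> p j) xs = excl (?a i j) (p i \<squnion> p j) (?x # xs)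
        + excl (gram (?p i) (?h i) (?p j) (?h j)) (?p i \<squnion> ?p j) (map (res ?x) xs)" for i j
      by (simp add: join_eq_mult_res_join excl_mult gram_mult)
    then have "(\<Sum>i\<in>I. \<Sum>j\<in>I. excl (?a i j) (p i \<squnion> p j) xs)
        = (\<Sum>i\<in>I. \<Sum>j\<in>I. excl (?a i j) (p i \<squnion> p j) (?x # xs))
        + (\<Sum>i\<in>I. \<Sum>j\<in>I. excl (gram (?p i) (?h i) (?p j) (?h j)) (?p i \<squnion> ?p j) (map (res ?x) xs))"
      by (simp add: sum.distrib del: excl.simps)
    moreover have "(\<Sum>i\<in>I. \<Sum>j\<in>I. excl (?a i j) (p i \<squnion> p j) (?x # xs)) \<in> \<real>\<^sub>\<ge>\<^sub>0"
    proof -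
      \<comment> \<open>In row and column \<open>k\<close> the base already absorbs
        \<open>?x\<close>.\<close>
      have zero: "excl (?a i j) (p i \<squnion> p j) (?x # xs) = 0" if "i = k \<or> j = k" for i j
        by (rule excl_eq_0[of ?x]) (use that in \<open>auto simp: ac_simps\<close>)
      have "(\<Sum>i\<in>I. \<Sum>j\<in>I. excl (?a i j) (p i \<squnion> p j) (?x # xs))
          = (\<Sum>i\<in>I - {k}. \<Sum>j\<in>I - {k}. excl (?a i j) (p i \<squnion> p j) (?x # xs))"
        by (simp add: sum.remove[OF \<open>finite I\<close> k(1)] zero del: excl.simps)
      moreover have "card (I - {k}) + (\<Sum>i\<in>I - {k}. len (p i)) < card I + (\<Sum>i\<in>I. len (p i))"
        using card_Diff1_less[OF \<open>finite I\<close> k(1)] by (simp add: sum.remove[OF \<open>finite I\<close> k(1)])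
      ultimately show ?thesis
        using less.hyps[of "I - {k}" p h "?x # xs"] \<open>finite I\<close> by (simp del: excl.simps)
    qed
    moreover have "(\<Sum>i\<in>I. \<Sum>j\<in>I.
        excl (gram (?p i) (?h i) (?p j) (?h j)) (?p i \<squnion> ?p j) (map (res ?x) xs)) \<in> \<real>\<^sub>\<ge>\<^sub>0"
    proof -
      \<comment> \<open>No length grows, and the point at \<open>k\<close> becomes 1;
        \<open>len_mult[of 1 1]\<close> yields \<open>len 1 = 0\<close>.\<close>
      have "(\<Sum>i\<in>I. len (?p i)) < (\<Sum>i\<in>I. len (p i))"
        using len_pos[OF k(2)] len_res[of ?x ?x] k len_mult[of 1 1]
        by (intro sum_strict_mono_ex1) (auto simp: less.prems len_res intro!: bexI[of _ k])
      then show ?thesis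
        using less.hyps[of I ?p] less.prems by simp
    qed
    ultimately show ?thesis by simp
  qed
qed

text \<open>\<open>A\<close> contains every indecomposable element, so positivity on
  \<open>A\<close> spreads to all finite lists.\<close>

theorem star_regular_dilation_iff_atoms:
  assumes split: "\<And>p. p \<noteq> 1 \<Longrightarrow> p \<notin> A \<Longrightarrow> \<exists>q r. q \<noteq> 1 \<and> r \<noteq> 1 \<and> p = q * r"
  shows "has_star_regular_dilation T \<longleftrightarrow>
    (\<forall>F. finite F \<and> F \<subseteq> A \<longrightarrow> positive_op (Z_op T F))"
proof (intro iffI allI impI)
  fix F assume "has_star_regular_dilation T" "finite F \<and> F \<subseteq> A"
  then show "positive_op (Z_op T F)"
    using finite_list[of F] dilation_imp_excl_nonneg positive_Z_op_iff by metis
next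
  assume pos: "\<forall>F. finite F \<and> F \<subseteq> A \<longrightarrow> positive_op (Z_op T F)"
  have excl_nonneg: "excl (qform h) 1 xs \<in> \<real>\<^sub>\<ge>\<^sub>0" for h xs
    by (rule excl_nonneg_of_atoms[OF split]) (use pos positive_Z_op_iff in blast)+
  show "has_star_regular_dilation T"
    unfolding has_star_regular_dilation_def completely_positive_definite_def
    \<comment> \<open>With the empty list \<open>excl\<close> only evaluates at
      \<open>p i \<squnion> p j\<close>, giving the kernel itself.\<close>
    using gram_nonneg[OF excl_nonneg, where xs = "[]"]
    by (auto simp: cinner_sum_left cinner_dilation_kernel)
qed

end

section \<open>Least common multiples in Thompson's monoid\<close>

text \<open>What is left of a word after the letter \<open>i\<close>, from the lcm squares of
  generators: for \<open>i < j\<close> the relation turns \<open>j\<close> into \<open>Suc j\<close>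
  and keeps \<open>i\<close>; for \<open>j < i\<close> it keeps \<open>j\<close> and turns
  \<open>i\<close> into \<open>Suc i\<close>.\<close>

fun res_word :: "nat \<Rightarrow> nat list \<Rightarrow> nat list" where
  "res_word i [] = []"
| "res_word i (j # w) =
    (if i = j then w else if i < j then Suc j # res_word i w else j # res_word (Suc i) w)"

text \<open>The opposite side of the same squares: what is left of \<open>i\<close> after the word,
  at most one letter.\<close>

fun res_letter :: "nat \<Rightarrow> nat list \<Rightarrow> nat list" where
  "res_letter i [] = [i]"
| "res_letter i (j # w) =
    (if i = j then [] else if i < j then res_letter i w else res_letter (Suc i) w)"

lemma equivclp_thompson_relation:
  "k < n \<Longrightarrow> equivclp thompson_step (n # k # v) (k # Suc n # v)"
  using thompson_step.intros[of k n "[]" v] by (auto intro: r_into_equivclp)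

lemma equivclp_thompson_Cons:
  "equivclp thompson_step v w \<Longrightarrow> equivclp thompson_step (i # v) (i # w)"
  using equivclp_thompson_step_append[of v w "[i]" "[]"] by simp

text \<open>Comparing \<open>i\<close> with \<open>k\<close> and \<open>n\<close>, the residuals of
  the two sides of a relation are equal or again differ by one relation.\<close>

lemma res_word_step_aux:
  "k < n \<Longrightarrow> equivclp thompson_step (res_word i (u @ [n, k] @ v)) (res_word i (u @ [k, n + 1] @ v))"
proof (induction u arbitrary: i)
  case Nil
  then show ?case
    by (auto intro: equivclp_thompson_relation)
next
  case (Cons j u)
  \<comment> \<open>Needed for \<open>i = j\<close>, where the letter cancels and the rest of the
    word is left as it is.\<close>
  have "equivclp thompson_step (u @ [n, k] @ v) (u @ [k, n + 1] @ v)"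
    using thompson_step.intros[OF Cons.prems] by (rule r_into_equivclp)
  with Cons show ?case
    by (auto intro: equivclp_thompson_Cons)
qed

lemma equivclp_res_word:
  assumes "equivclp thompson_step v w"
  shows "equivclp thompson_step (res_word i v) (res_word i w)"
  using assms
proof (induction rule: equivclp_induct)
  case (step y z)
  then have "equivclp thompson_step (res_word i y) (res_word i z)"
    using res_word_step_aux by (auto elim!: thompson_step.cases intro: equivclp_sym)
  then show ?case
    using step.IH by (rule equivclp_trans[rotated])
qed simp

text \<open>The squares of the single letters are pasted along \<open>w\<close>; both sides
  represent the least common multiple.\<close>

lemma Cons_res_word: "equivclp thompson_step (i # res_word i w) (w @ res_letter i w)"
proof (induction w arbitrary: i)
  case (Cons j w)
  consider "i = j" | "i < j" | "j < i" by linarith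
  then show ?case
  proof cases
    case 2
    then show ?thesis
      using equivclp_trans[OF equivclp_sym[OF equivclp_thompson_relation]
          equivclp_thompson_Cons[OF Cons.IH]] by simp
  next
    case 3
    then show ?thesis
      using equivclp_trans[OF equivclp_thompson_relation equivclp_thompson_Cons[OF Cons.IH]] by simp
  qed simp
qed simp

lemma res_word_append: "\<exists>t. res_word i (v @ w) = res_word i v @ t"
  by (induction v arbitrary: i) auto

lemma length_res_word: "length (res_word i w) \<le> length w"
proof (induction w arbitrary: i)
  case (Cons j w)
  then show ?case by (auto simp: le_SucI)
qed simp

section \<open>Passage from words to the monoid\<close>

lift_definition thompson_res :: "nat \<Rightarrow> thompson \<Rightarrow> thompson" is res_word
  by (rule equivclp_res_word)

lift_definition thompson_len :: "thompson \<Rightarrow> nat" is length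
proof -
  fix v w assume "equivclp thompson_step v w"
  then show "length v = length w"
    by (induction rule: equivclp_induct) (auto elim!: thompson_step.cases)
qed

lemma thompson_induct [case_names one gen_mult]:
  assumes "P 1" "\<And>i p. P p \<Longrightarrow> P (thompson_gen i * p)"
  shows "P p"
proof (induction p rule: thompson.abs_induct)
  case (1 w)
  show ?case
  proof (induction w)
    case Nil
    then show ?case using assms(1) by (simp add: one_thompson.abs_eq)
  next
    case (Cons i w)
    then show ?case
      using assms(2)[of "abs_thompson w" i] by (simp add: thompson_gen.abs_eq times_thompson.abs_eq)
  qed
qed

lemma thompson_res_gen_mult: "thompson_res i (thompson_gen i * p) = p"
  by transfer simp

lemma thompson_gen_mult_res: "thompson_gen i * thompson_res i p \<in> right_ideal p"
  unfolding right_ideal_def image_iff bex_UNIV by transfer (use Cons_res_word in auto)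

lemma thompson_res_mult: "thompson_res i (p * q) \<in> right_ideal (thompson_res i p)"
  unfolding right_ideal_def image_iff bex_UNIV
  by transfer (metis equivclp_refl res_word_append)

lemma thompson_len_res: "thompson_len (thompson_res i p) \<le> thompson_len p"
  by transfer (rule length_res_word)

lemma thompson_len_mult: "thompson_len (p * q) = thompson_len p + thompson_len q"
  by transfer simp

lemma thompson_len_gen: "thompson_len (thompson_gen i) = 1"
  by transfer simp

lemma thompson_len_eq_0: "thompson_len p = 0 \<Longrightarrow> p = 1"
  by transfer simp

text \<open>Residuation by a generator undoes left multiplication by it.\<close>

lemma thompson_left_cancel:
  fixes p q r :: thompson
  assumes "p * q = p * r"
  shows "q = r"
  using assms
  by (induction p rule: thompson_induct) (simp, metis mult.assoc thompson_res_gen_mult)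

text \<open>If a generator times \<open>t\<close> equals \<open>p * u\<close>, residuation by the
  generator shows that \<open>t\<close> is a multiple of the residual of \<open>p\<close>.\<close>

lemma right_ideal_thompson_gen_Int:
  "right_ideal (thompson_gen i) \<inter> right_ideal p = right_ideal (thompson_gen i * thompson_res i p)"
proof (intro equalityI subsetI)
  fix s assume "s \<in> right_ideal (thompson_gen i) \<inter> right_ideal p"
  then obtain t u where "s = thompson_gen i * t" "s = p * u"
    unfolding right_ideal_def by blast
  then have "t \<in> right_ideal (thompson_res i p)"
    using thompson_res_mult[of i p u] thompson_res_gen_mult[of i t] by metis
  with \<open>s = thompson_gen i * t\<close> show "s \<in> right_ideal (thompson_gen i * thompson_res i p)"
    by (auto simp: right_ideal_def mult.assoc)
next
  fix s assume "s \<in> right_ideal (thompson_gen i * thompson_res i p)"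
  then show "s \<in> right_ideal (thompson_gen i) \<inter> right_ideal p"
    using thompson_gen_mult_res[of i p] unfolding right_ideal_def
    by (clarsimp simp: mult.assoc) (metis mult.assoc rangeI)
qed

text \<open>Multiples of \<open>thompson_gen i * p\<close> are multiples of the generator, so it
  factors out of the intersection and leaves \<open>p\<close> and the residual of
  \<open>q\<close>.\<close>

lemma thompson_lcm_exists:
  "\<exists>s. right_ideal p \<inter> right_ideal q = right_ideal s \<and>
    thompson_len s \<le> thompson_len p + thompson_len (q :: thompson)"
proof (induction p arbitrary: q rule: thompson_induct)
  case one
  have "right_ideal (1 :: thompson) = UNIV" by (auto simp: right_ideal_def)
  then show ?case by auto
next
  case (gen_mult i p)
  let ?x = "thompson_gen i"
  obtain s where s: "right_ideal p \<inter> right_ideal (thompson_res i q) = right_ideal s"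
      "thompson_len s \<le> thompson_len p + thompson_len (thompson_res i q)"
    using gen_mult by blast
  have "right_ideal (?x * p) \<inter> right_ideal q
      = right_ideal (?x * p) \<inter> (right_ideal ?x \<inter> right_ideal q)"
    by (auto simp: right_ideal_def mult.assoc)
  also have "\<dots> = (\<lambda>t. ?x * t) ` (right_ideal p \<inter> right_ideal (thompson_res i q))"
    unfolding right_ideal_thompson_gen_Int right_ideal_mult
    by (rule image_Int[symmetric]) (auto intro: injI thompson_left_cancel)
  finally have "right_ideal (?x * p) \<inter> right_ideal q = right_ideal (?x * s)"
    by (simp add: s right_ideal_mult)
  moreover have "thompson_len (?x * s) \<le> thompson_len (?x * p) + thompson_len q"
    using s(2) thompson_len_res[of i q] by (simp add: thompson_len_mult)
  ultimately show ?case by blast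
qed

interpretation thompson: graded_lcm_monoid thompson_len
  by standard
    (rule thompson_len_mult thompson_len_eq_0 thompson_left_cancel thompson_lcm_exists; assumption?)+

theorem theorem5p7:
  fixes T :: "thompson \<Rightarrow> ('h::complex_hilbert_space \<Rightarrow>\<^sub>L 'h)"
  assumes "contractive_representation T"
  shows "has_star_regular_dilation T \<longleftrightarrow>
    (\<forall>F. finite F \<and> F \<subseteq> range thompson_gen \<longrightarrow> positive_op (Z_op T F))"
proof -
  interpret graded_lcm_representation thompson_len T
    by standard (rule assms)
  show ?thesis
  proof (rule star_regular_dilation_iff_atoms)
    fix p assume "p \<noteq> 1" "p \<notin> range thompson_gen"
    \<comment> \<open>The first letter of a word for \<open>p\<close> splits off; the rest is
      nontrivial since \<open>p\<close> is not a generator.\<close>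
    then obtain i q where "p = thompson_gen i * q" "q \<noteq> 1"
      by (induction p rule: thompson_induct) (simp, metis mult.right_neutral rangeI)
    moreover have "thompson_gen i \<noteq> 1"
      using thompson_len_gen[of i] thompson_len_mult[of 1 1] by auto
    ultimately show "\<exists>q r. q \<noteq> 1 \<and> r \<noteq> 1 \<and> p = q * r" by blast
  qed
qed

end
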